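(* Let $n\ge 1$ be an integer and let $z\le 0$ be real. Then $$\int_0^1 q^n\,\zeta(z,q)\,dq=-\,n!\sum_{j=1}^{n}\frac{\zeta(z-j)}{(z-j)_j\,(n-j+1)!}=n!\sum_{j=1}^{n}(-1)^{j+1}\frac{\zeta(z-j)}{(1-z)_j\,(n-j+1)!}.$$
   Context: $\zeta(z,q)$ denotes the Hurwitz zeta function: for $q>0$ it is $\sum_{n=0}^{\infty}(n+q)^{-z}$ when $\mathrm{Re}(z)>1$, extended by analytic continuation in $z$ to $\mathbb{C}\setminus\{1\}$. $\zeta(s)=\zeta(s,1)$ is the Riemann zeta function. $(x)_k=x(x+1)\cdots(x+k-1)$ is the Pochhammer symbol. *)

theory Defs
  imports "HOL-Complex_Analysis.Complex_Analysis"
begin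

text \<open>
  \<open>f\<close> is the analytic continuation to \<open>\<complex> - {1}\<close> of the Hurwitz series with parameter \<open>q\<close>.
  For \<open>q > 0\<close> the bases of the powers are positive reals, so \<open>powr\<close> is the usual power.
\<close>
definition hurwitz_continuation :: "real \<Rightarrow> (complex \<Rightarrow> complex) \<Rightarrow> bool" where
  "hurwitz_continuation q f \<longleftrightarrow>
     f holomorphic_on (- {1}) \<and>
     (\<forall>s. Re s > 1 \<longrightarrow> (\<lambda>n. (of_nat n + of_real q) powr (- s)) sums f s)"

text \<open>
  Only meaningful for \<open>q > 0\<close> and \<open>s \<noteq> 1\<close>. The description ranges over the value at \<open>s\<close>
  and not over the continuation itself, since the value of the latter at \<open>1\<close> is arbitrary.
\<close>
definition hurwitz_zeta :: "complex \<Rightarrow> real \<Rightarrow> complex" where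
  "hurwitz_zeta s q = (THE w. \<exists>f. hurwitz_continuation q f \<and> w = f s)"

definition riemann_zeta :: "complex \<Rightarrow> complex" where
  "riemann_zeta s = hurwitz_zeta s 1"

lemma hurwitz_continuation_unique:
  assumes f: "hurwitz_continuation q f" and g: "hurwitz_continuation q g" and s: "s \<noteq> 1"
  shows "f s = g s"
proof -
  have eq: "f w - g w = 0" if "w \<in> {w. Re w > 1}" for w
    using f g that sums_unique2 unfolding hurwitz_continuation_def by fastforce
  have "(\<lambda>w. f w - g w) holomorphic_on (- {1})"
    using f g unfolding hurwitz_continuation_def by (auto intro: holomorphic_on_diff)
  moreover have "connected (- {1 :: complex})"
    by (rule connected_punctured_universe) simp
  moreover have "(2 :: complex) islimpt {w. Re w > 1}"
    by (rule interior_limit_point) (simp add: interior_open open_halfspace_Re_gt)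
  ultimately have "f s - g s = 0"
    using analytic_continuation[of "\<lambda>w. f w - g w" "- {1}" "{w. Re w > 1}" 2 s] eq s
    by auto
  then show ?thesis by simp
qed

lemma hurwitz_zeta_eq:
  assumes "hurwitz_continuation q f" and "s \<noteq> 1"
  shows "hurwitz_zeta s q = f s"
  unfolding hurwitz_zeta_def
  using assms hurwitz_continuation_unique by (intro the_equality) blast+

end

theory Submission
  imports Defs
begin

text \<open>
  Since \<open>\<partial>\<^sub>q \<zeta>(z-1,q) = (1-z) \<zeta>(z,q)\<close>, integrating \<open>q\<^sup>n \<zeta>(z,q)\<close> by parts expresses it through \<open>\<zeta>(z-1)\<close> and
  the integral of \<open>q\<^bsup>n-1\<^esup> \<zeta>(z-1,q)\<close>. The boundary term at \<open>0\<close> is controlled by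
  \<open>\<zeta>(s,q) = q\<^bsup>-s\<^esup> + \<zeta>(s,q+1)\<close>, which extends \<open>\<zeta>(s,\<cdot>)\<close> continuously to \<open>q = 0\<close> with value \<open>\<zeta>(s)\<close> when
  \<open>Re s < 0\<close>; for the same reason the integral vanishes for \<open>n = 0\<close>.
  The continuation of \<open>\<zeta>(s,q)\<close> is obtained together with its \<open>q\<close>-derivative, by integrating
  \<open>\<partial>\<^sub>q \<zeta>(s,q) = - s \<zeta>(s+1,q)\<close> to move the domain to the left one unit at a time.
\<close>

section \<open>The Hurwitz series\<close>

text \<open>The power (n + q)^(-s) through the real logarithm: its norm and its derivatives in
  \<open>s\<close> and \<open>q\<close> are then those of an exponential.\<close>

definition hurwitz_term :: "nat \<Rightarrow> complex \<Rightarrow> real \<Rightarrow> complex" where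
  "hurwitz_term n s q = exp (- s * of_real (ln (real n + q)))"

definition hurwitz_series :: "complex \<Rightarrow> real \<Rightarrow> complex" where
  "hurwitz_series s q = (\<Sum>n. hurwitz_term n s q)"

lemma powr_eq_hurwitz_term:
  assumes "q > 0"
  shows "(of_nat n + of_real q) powr (- s) = hurwitz_term n s q"
proof -
  have "complex_of_real (real n + q) \<noteq> 0"
    using assms by (metis add_nonneg_pos less_irrefl of_nat_0_le_iff of_real_eq_0_iff)
  moreover have "Ln (complex_of_real (real n + q)) = of_real (ln (real n + q))"
    using assms by (intro Ln_of_real) auto
  ultimately show ?thesis
    by (simp add: powr_def hurwitz_term_def)
qed

section \<open>Majorants and uniform convergence\<close>

lemma norm_hurwitz_term: "norm (hurwitz_term n s q) = exp (- Re s * ln (real n + q))"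
  by (simp add: hurwitz_term_def)

text \<open>Dropping \<open>q\<close> from the base makes the majorant uniform in \<open>q\<close>.
  This requires n >= 1: the term for n = 0 is q^(-s), which is unbounded near q = 0 when Re s >
  0.\<close>

lemma norm_hurwitz_term_le:
  assumes "n \<ge> 1" "q > 0" "Re s \<ge> c" "c \<ge> 0"
  shows "norm (hurwitz_term n s q) \<le> real n powr (- c)"
proof -
  have "c * ln (real n) \<le> Re s * ln (real n + q)"
    using assms by (intro mult_mono) auto
  then show ?thesis
    using assms by (simp add: norm_hurwitz_term powr_def)
qed

text \<open>The logarithm is at most (2/d) x^(d/2), so it costs half of the excess \<open>d\<close>
  of the exponent over 1, and the rest keeps the majorant summable.\<close>

lemma norm_ln_mult_hurwitz_term_le:
  assumes "n \<ge> 1" "q > 0" "Re s \<ge> 1 + d" "d > 0"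
  shows "norm (- of_real (ln (real n + q)) * hurwitz_term n s q) \<le> 2 / d * real n powr (- (1 + d / 2))"
proof -
  define x where "x = real n + q"
  have x: "x \<ge> 1" "x \<ge> real n" "x > 0" using assms by (auto simp: x_def)
  have "ln x \<le> x powr (d / 2) / (d / 2)"
    using x assms by (intro ln_powr_bound) auto
  moreover have "exp (- Re s * ln x) \<le> x powr (- (1 + d))"
    using x mult_right_mono[OF assms(3), of "ln x"] by (simp add: powr_def algebra_simps)
  ultimately have "ln x * exp (- Re s * ln x) \<le> x powr (d / 2) / (d / 2) * x powr (- (1 + d))"
    using x assms by (intro mult_mono) auto
  also have "\<dots> = 2 / d * x powr (- (1 + d / 2))"
    by (simp add: algebra_simps flip: powr_add)
  also have "\<dots> \<le> 2 / d * real n powr (- (1 + d / 2))"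
    using x assms by (intro mult_left_mono powr_mono2') auto
  finally show ?thesis
    using x by (simp add: norm_mult norm_hurwitz_term x_def)
qed

lemma summable_hurwitz_term:
  assumes "Re s > 1" "q > 0"
  shows "summable (\<lambda>n. hurwitz_term n s q)"
proof (rule summable_comparison_test_ev)
  show "\<forall>\<^sub>F n in sequentially. norm (hurwitz_term n s q) \<le> real n powr (- Re s)"
    using eventually_ge_at_top[of 1] by eventually_elim (use assms in \<open>auto intro!: norm_hurwitz_term_le\<close>)
  show "summable (\<lambda>n. real n powr (- Re s))"
    using assms by (subst summable_real_powr_iff) auto
qed

text \<open>The M-test with a majorant that holds from n = 1 on; the unbounded term for n = 0 does
  not affect uniform convergence.\<close>

lemma uniform_limit_hurwitz_series:
  assumes "d > 0"
  shows "uniform_limit ({s. 1 + d \<le> Re s} \<times> {0<..}) (\<lambda>n (s, q). \<Sum>i<n. hurwitz_term i s q)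
           (\<lambda>(s, q). hurwitz_series s q) sequentially"
  unfolding hurwitz_series_def case_prod_unfold
proof (rule Weierstrass_m_test_ev)
  show "summable (\<lambda>n. real n powr (- (1 + d)))"
    using assms by (subst summable_real_powr_iff) auto
  show "\<forall>\<^sub>F n in sequentially. \<forall>x\<in>{s. 1 + d \<le> Re s} \<times> {0<..}.
          norm (hurwitz_term n (fst x) (snd x)) \<le> real n powr (- (1 + d))"
    using eventually_ge_at_top[of 1] by eventually_elim (use assms norm_hurwitz_term_le[where c = "1 + d"] in auto)
qed

lemma uniform_limit_hurwitz_series_deriv:
  assumes "d > 0"
  shows "uniform_limit ({s. 1 + d \<le> Re s} \<times> {0<..})
           (\<lambda>n (s, q). \<Sum>i<n. - of_real (ln (real i + q)) * hurwitz_term i s q)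
           (\<lambda>(s, q). \<Sum>i. - of_real (ln (real i + q)) * hurwitz_term i s q) sequentially"
  unfolding case_prod_unfold
proof (rule Weierstrass_m_test_ev)
  show "summable (\<lambda>n. 2 / d * real n powr (- (1 + d / 2)))"
    using assms by (intro summable_mult, subst summable_real_powr_iff) auto
  show "\<forall>\<^sub>F n in sequentially. \<forall>x\<in>{s. 1 + d \<le> Re s} \<times> {0<..}.
          norm (- of_real (ln (real n + snd x)) * hurwitz_term n (fst x) (snd x))
            \<le> 2 / d * real n powr (- (1 + d / 2))"
    using eventually_ge_at_top[of 1]
    by eventually_elim (use assms norm_ln_mult_hurwitz_term_le in auto)
qed

section \<open>Families holomorphic in \<open>s\<close> and jointly continuous in
  \<open>(s, q)\<close>\<close>

lemma continuous_on_halfplane_prodI: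
  fixes f :: "complex \<times> real \<Rightarrow> complex"
  assumes "\<And>d. d > 0 \<Longrightarrow> continuous_on ({s. c + d \<le> Re s} \<times> {0<..}) f"
  shows "continuous_on ({s. c < Re s} \<times> {0<..}) f"
proof -
  have "isCont f (s, q)" if "c < Re s" "q > 0" for s q
  proof -
    \<comment> \<open>Half the distance from \<open>s\<close> to the boundary line, so that
      \<open>s\<close> is interior to the smaller half-plane on which continuity is known.\<close>
    define d where "d = (Re s - c) / 2"
    have "continuous_on ({s. c + d < Re s} \<times> {0<..}) f"
      by (rule continuous_on_subset[OF assms[of d]]) (use that in \<open>auto simp: d_def\<close>)
    moreover have "open ({s. c + d < Re s} \<times> {0::real<..})"
      by (intro open_Times open_halfspace_Re_gt) auto
    ultimately show ?thesis
      using that by (auto simp: continuous_on_eq_continuous_at d_def field_simps)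
  qed
  then show ?thesis
    by (intro continuous_at_imp_continuous_on) auto
qed

text \<open>Joint continuity of the derivative is what makes the class stable under integration in \<open>q\<close>.\<close>

definition smooth_family :: "real \<Rightarrow> (complex \<Rightarrow> real \<Rightarrow> complex) \<Rightarrow> bool" where
  "smooth_family c G \<longleftrightarrow> (\<exists>G'.
     (\<forall>s q. c < Re s \<longrightarrow> 0 < q \<longrightarrow> ((\<lambda>s. G s q) has_field_derivative G' s q) (at s)) \<and>
     continuous_on ({s. c < Re s} \<times> {0<..}) (\<lambda>(s, q). G s q) \<and>
     continuous_on ({s. c < Re s} \<times> {0<..}) (\<lambda>(s, q). G' s q))"

lemma smooth_family_holomorphic:
  assumes "smooth_family c G" "q > 0"
  shows "(\<lambda>s. G s q) holomorphic_on {s. c < Re s}"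
proof -
  from assms(1) obtain G' where
    "\<And>s q. c < Re s \<Longrightarrow> 0 < q \<Longrightarrow> ((\<lambda>s. G s q) has_field_derivative G' s q) (at s)"
    unfolding smooth_family_def by blast
  with assms(2) show ?thesis
    by (auto simp: holomorphic_on_open open_halfspace_Re_gt)
qed

lemma smooth_family_continuous:
  assumes "smooth_family c G" "c < Re s"
  shows "continuous_on {0<..} (G s)"
proof -
  have "continuous_on ({s. c < Re s} \<times> {0<..}) (\<lambda>(s, q). G s q)"
    using assms(1) by (auto simp: smooth_family_def)
  from continuous_on_compose2[OF this, of "{0<..}" "\<lambda>q. (s, q)"] show ?thesis
    using assms(2) by (simp add: continuous_on_Pair image_subset_iff)
qed

lemma smooth_family_hurwitz_series: "smooth_family 1 hurwitz_series"
proof -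
  \<comment> \<open>The series differentiated term by term in \<open>s\<close>.\<close>
  define G' where "G' = (\<lambda>s q. \<Sum>n. - of_real (ln (real n + q)) * hurwitz_term n s q)"
  have cont: "continuous_on ({s. 1 + d \<le> Re s} \<times> {0<..}) (\<lambda>(s, q). hurwitz_term n s q)" for n d
    unfolding hurwitz_term_def case_prod_unfold by (intro continuous_intros) auto
  have contl: "continuous_on ({s. 1 + d \<le> Re s} \<times> {0<..}) (\<lambda>(s, q). - of_real (ln (real n + q)) * hurwitz_term n s q)" for n d
    unfolding hurwitz_term_def case_prod_unfold by (intro continuous_intros) auto
  note contl' = contl[unfolded case_prod_unfold mult_minus_left]
  have "((\<lambda>s. hurwitz_series s q) has_field_derivative G' s q) (at s)" if "1 < Re s" "q > 0" for s q
  proof -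
    define d where "d = (Re s - 1) / 2"
    have d: "d > 0" "1 + d < Re s" using that by (auto simp: d_def field_simps)
    have s: "s \<in> interior {s. 1 + d \<le> Re s}"
      by (rule interiorI[of "{s. 1 + d < Re s}"]) (use d in \<open>auto simp: open_halfspace_Re_gt\<close>)
    show ?thesis unfolding hurwitz_series_def G'_def
    proof (rule has_field_derivative_series'[where S = "{s. 1 + d \<le> Re s}"])
      show "convex {s. 1 + d \<le> Re s}" by (rule convex_halfspace_Re_ge)
      show "((\<lambda>s. hurwitz_term n s q) has_field_derivative - of_real (ln (real n + q)) * hurwitz_term n s q)
              (at s within {s. 1 + d \<le> Re s})" for n s
        unfolding hurwitz_term_def by (auto intro!: derivative_eq_intros)
      show "uniformly_convergent_on {s. 1 + d \<le> Re s}
              (\<lambda>n s. \<Sum>i<n. - complex_of_real (ln (real i + q)) * hurwitz_term i s q)"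
        unfolding uniformly_convergent_on_def
        using uniform_limit_compose'[OF uniform_limit_hurwitz_series_deriv[OF d(1)], of "\<lambda>s. (s, q)" "{s. 1 + d \<le> Re s}"] that
        by auto
      show "s \<in> {s. 1 + d \<le> Re s}" using d by auto
      show "summable (\<lambda>n. hurwitz_term n s q)" using that by (rule summable_hurwitz_term)
      show "s \<in> interior {s. 1 + d \<le> Re s}" by (rule s)
    qed
  qed
  moreover have "continuous_on ({s. 1 < Re s} \<times> {0<..}) (\<lambda>(s, q). hurwitz_series s q)"
    by (rule continuous_on_halfplane_prodI, rule uniform_limit_theorem[OF _ uniform_limit_hurwitz_series])
       (auto intro!: always_eventually continuous_on_sum cont[unfolded case_prod_unfold] simp: case_prod_unfold)
  moreover have "continuous_on ({s. 1 < Re s} \<times> {0<..}) (\<lambda>(s, q). G' s q)"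
    unfolding G'_def
    by (rule continuous_on_halfplane_prodI, rule uniform_limit_theorem[OF _ uniform_limit_hurwitz_series_deriv])
       (auto intro!: always_eventually continuous_on_sum contl' simp: case_prod_unfold)
  ultimately show ?thesis
    unfolding smooth_family_def by blast
qed

text \<open>Termwise differentiation: the \<open>q\<close>-derivative of (n + q)^(-s) is -s (n +
  q)^(-s-1), and the series of these converges uniformly in q > 0.\<close>

lemma hurwitz_series_has_vector_derivative:
  assumes "Re s > 1" "q > 0"
  shows "(hurwitz_series s has_vector_derivative - s * hurwitz_series (s + 1) q) (at q)"
proof -
  have ul: "uniform_limit {0<..} (\<lambda>n q. \<Sum>i<n. - s * hurwitz_term i (s + 1) q) 
             (\<lambda>q. - s * hurwitz_series (s + 1) q) sequentially"
    unfolding sum_distrib_left[symmetric]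
    \<comment> \<open>The margin d = 1 is available because Re (s + 1) > 2.\<close>
    using uniform_limit_compose'[OF uniform_limit_hurwitz_series[of 1], of "\<lambda>q. (s + 1, q)" "{0<..}"] assms
    by (intro uniform_limit_intros) auto
  have "\<exists>g. \<forall>q\<in>{0<..}. (\<lambda>n. hurwitz_term n s q) sums g q \<and>
          (g has_derivative (\<lambda>h. h *\<^sub>R (- s * hurwitz_series (s + 1) q))) (at q within {0<..})"
  proof (rule has_derivative_series)
    show "convex {0::real<..}" by simp
    show "(hurwitz_term n s has_derivative (\<lambda>h. h *\<^sub>R (- s * hurwitz_term n (s + 1) q)))
            (at q within {0<..})" if "q \<in> {0<..}" for n q
    proof -
      have pos: "real n + q > 0" using that by (simp add: add_nonneg_pos)
      have e: "exp (complex_of_real (ln (real n + q))) = of_nat n + of_real q"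
        using pos by (simp add: exp_of_real)
      have "((\<lambda>q. ln (real n + q)) has_field_derivative inverse (real n + q)) (at q within {0<..})"
        using pos by (auto intro!: derivative_eq_intros simp: inverse_eq_divide)
      then have "((\<lambda>q. complex_of_real (ln (real n + q))) has_vector_derivative of_real (inverse (real n + q))) (at q within {0<..})"
        by (rule has_vector_derivative_of_real)
      then have "((\<lambda>q. - s * complex_of_real (ln (real n + q))) has_vector_derivative - s * of_real (inverse (real n + q))) (at q within {0<..})"
        by (rule has_vector_derivative_mult_right)
      from field_vector_diff_chain_within[OF this, of exp]
      have "((exp \<circ> (\<lambda>q. - s * complex_of_real (ln (real n + q)))) has_vector_derivative
             (- s * of_real (inverse (real n + q)) * exp (- s * complex_of_real (ln (real n + q))))) (at q within {0<..})"
        using DERIV_exp has_field_derivative_at_within by blast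
      also have "- s * of_real (inverse (real n + q)) * exp (- s * complex_of_real (ln (real n + q))) = 
           - s * hurwitz_term n (s + 1) q"
        by (simp add: hurwitz_term_def ring_distribs exp_diff e divide_inverse)
      finally show ?thesis
        by (simp add: has_vector_derivative_def hurwitz_term_def[abs_def] o_def)
    qed
    show "\<forall>\<^sub>F n in sequentially. \<forall>q\<in>{0<..}. \<forall>h. norm ((\<Sum>i<n. h *\<^sub>R (- s * hurwitz_term i (s + 1) q)) -
             h *\<^sub>R (- s * hurwitz_series (s + 1) q)) \<le> e * norm h" if "e > 0" for e
      using uniform_limitD[OF ul that]
    proof eventually_elim
      case (elim n)
      show ?case
      proof (intro ballI allI)
        fix q h :: real assume "q \<in> {0<..}"
        with elim have "dist (\<Sum>i<n. - s * hurwitz_term i (s + 1) q) (- s * hurwitz_series (s + 1) q) < e"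
          by blast
        then have "\<bar>h\<bar> * norm ((\<Sum>i<n. - s * hurwitz_term i (s + 1) q) - (- s * hurwitz_series (s + 1) q)) \<le> \<bar>h\<bar> * e"
          unfolding dist_norm by (intro mult_left_mono) auto
        then show "norm ((\<Sum>i<n. h *\<^sub>R (- s * hurwitz_term i (s + 1) q)) -
             h *\<^sub>R (- s * hurwitz_series (s + 1) q)) \<le> e * norm h"
          by (simp only: scaleR_sum_right[symmetric] scaleR_diff_right[symmetric] norm_scaleR real_norm_def mult.commute)
      qed
    qed
    show "(\<lambda>n. hurwitz_term n s q) sums hurwitz_series s q"
      unfolding hurwitz_series_def using assms by (intro summable_sums summable_hurwitz_term)
    show "q \<in> {0<..}" using assms by simp
  qed
  \<comment> \<open>The termwise theorem yields only some limit function \<open>g\<close>;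
    uniqueness of sums identifies it with \<open>hurwitz_series s\<close> on q > 0.\<close>
  then obtain g where g: "\<And>q. q > 0 \<Longrightarrow> (\<lambda>n. hurwitz_term n s q) sums g q"
    "\<And>q. q > 0 \<Longrightarrow> (g has_vector_derivative - s * hurwitz_series (s + 1) q) (at q within {0<..})"
    by (auto simp: has_vector_derivative_def)
  have "(g has_vector_derivative - s * hurwitz_series (s + 1) q) (at q)"
    using g(2)[OF assms(2)] assms(2) by (simp add: at_within_open[of _ "{0<..}"])
  then show ?thesis
    by (rule has_vector_derivative_transform_within_open[of _ _ _ "{0<..}"])
       (use assms g(1) in \<open>auto simp: hurwitz_series_def sums_iff\<close>)
qed

section \<open>Shifting the half-plane to the left\<close>

text \<open>
  The Hurwitz zeta function satisfies \<open>\<partial>\<^sub>q \<zeta>(s,q) = - s \<zeta>(s+1,q)\<close> and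
  \<open>(s - 1) \<integral>\<^bsub>1\<^esub>\<^bsup>2\<^esup> \<zeta>(s,u) du = 1\<close>, and these two properties determine \<open>\<zeta>(s,\<cdot>)\<close> from \<open>\<zeta>(s+1,\<cdot>)\<close>.
  This is the resulting formula for \<open>(s - 1) \<zeta>(s,q)\<close>, which has no pole, in terms of \<open>s \<zeta>(s+1,\<cdot>)\<close>.
\<close>

definition left_shift :: "(complex \<Rightarrow> real \<Rightarrow> complex) \<Rightarrow> complex \<Rightarrow> real \<Rightarrow> complex" where
  "left_shift G s q = 1 + (s - 1) * integral {0..1} (\<lambda>t.
     of_real (1 - t) * G (s + 1) (1 + t) - of_real (q - 1) * G (s + 1) (1 + t * (q - 1)))"

text \<open>The point is a convex combination of 1 and \<open>q\<close>, so the path from 1 to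
  \<open>q\<close> stays within the positive parameters.\<close>

lemma segment_pos:
  fixes q t :: real
  assumes "q > 0" "0 \<le> t" "t \<le> 1"
  shows "1 + t * (q - 1) > 0"
proof (cases "q \<ge> 1")
  case True
  then show ?thesis using assms by (simp add: add_pos_nonneg)
next
  case False
  then have "t * (1 - q) \<le> 1 * (1 - q)"
    using assms by (intro mult_right_mono) auto
  then show ?thesis using assms by (simp add: algebra_simps)
qed

text \<open>Both integrals run over the fixed interval [0,1], with \<open>q\<close> only in the
  integrand, so differentiation under the integral sign and continuity of parameter integrals
  apply.\<close>

lemma smooth_family_left_shift:
  assumes "smooth_family c G"
  shows "smooth_family (c - 1) (left_shift G)"
proof -
  from assms obtain G' where G':
    "\<And>s q. c < Re s \<Longrightarrow> 0 < q \<Longrightarrow> ((\<lambda>s. G s q) has_field_derivative G' s q) (at s)"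
    "continuous_on ({s. c < Re s} \<times> {0<..}) (\<lambda>(s, q). G s q)"
    "continuous_on ({s. c < Re s} \<times> {0<..}) (\<lambda>(s, q). G' s q)"
    unfolding smooth_family_def by blast
  define D where "D = {s. c - 1 < Re s} \<times> {0::real<..}"
  \<comment> \<open>The integrand of \<open>left_shift\<close> with \<open>H\<close> left open: it
    is used for \<open>G\<close> and for its \<open>s\<close>-derivative \<open>G'\<close>.\<close>
  define K where "K = (\<lambda>(H :: complex \<Rightarrow> real \<Rightarrow> complex) x t.
    of_real (1 - t) * H (fst x + 1) (1 + t) - of_real (snd x - 1) * H (fst x + 1) (1 + t * (snd x - 1)))"
  have contK: "continuous_on (D \<times> {0..1}) (\<lambda>(x, t). K H x t)"
    if "continuous_on ({s. c < Re s} \<times> {0<..}) (\<lambda>(s, q). H s q)" for H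
  proof -
    have "continuous_on (D \<times> {0..1}) (\<lambda>y. (\<lambda>(s, q). H s q) (fst (fst y) + 1, 1 + snd y))"
      by (rule continuous_on_compose2[OF that]) (auto intro!: continuous_intros simp: D_def)
    moreover have "continuous_on (D \<times> {0..1}) (\<lambda>y. (\<lambda>(s, q). H s q) (fst (fst y) + 1, 1 + snd y * (snd (fst y) - 1)))"
      by (rule continuous_on_compose2[OF that])
         (auto intro!: continuous_intros segment_pos simp: D_def)
    ultimately show ?thesis
      unfolding K_def case_prod_unfold by (auto intro!: continuous_intros)
  qed
  have contI: "continuous_on D (\<lambda>x. integral {0..1} (K H x))"
    if "continuous_on ({s. c < Re s} \<times> {0<..}) (\<lambda>(s, q). H s q)" for H
    using integral_continuous_on_param[of D 0 1 "K H"] contK[OF that] by simp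
  have contt: "continuous_on {0..1} (K H x)"
    if "continuous_on ({s. c < Re s} \<times> {0<..}) (\<lambda>(s, q). H s q)" "x \<in> D" for H x
    using continuous_on_compose2[OF contK[OF that(1)], of "{0..1}" "\<lambda>t. (x, t)"] that(2)
    by (auto simp: continuous_on_Pair)
  have "((\<lambda>s. integral {0..1} (K G (s, q))) has_field_derivative integral {0..1} (K G' (s, q))) (at s)"
    if "c - 1 < Re s" "q > 0" for s q
  proof -
    have "((\<lambda>s. integral (cbox 0 1) (\<lambda>t. K G (s, q) t)) has_field_derivative
             integral (cbox 0 1) (\<lambda>t. K G' (s, q) t)) (at s within {s. c - 1 < Re s})"
    proof (rule leibniz_rule_field_derivative)
      show "((\<lambda>s. K G (s, q) t) has_field_derivative K G' (s, q) t) (at s within {s. c - 1 < Re s})"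
        if "s \<in> {s. c - 1 < Re s}" "t \<in> cbox 0 1" for s t
      proof -
        have "((\<lambda>s. G (s + 1) x) has_field_derivative G' (s + 1) x) (at s within {s. c - 1 < Re s})"
          if "x > 0" for x
        proof (rule has_field_derivative_at_within)
          show "((\<lambda>s. G (s + 1) x) has_field_derivative G' (s + 1) x) (at s)"
            using G'(1)[of "s + 1" x] \<open>s \<in> _\<close> that by (intro DERIV_shift[THEN iffD1]) auto
        qed
        then show ?thesis
          unfolding K_def using that segment_pos[of q t] \<open>q > 0\<close> by (auto intro!: derivative_eq_intros)
      qed
      show "K G (s, q) integrable_on cbox 0 1" if "s \<in> {s. c - 1 < Re s}" for s
        using that \<open>q > 0\<close> by (auto intro!: integrable_continuous_interval contt[OF G'(2)] simp: D_def)
      show "continuous_on ({s. c - 1 < Re s} \<times> cbox 0 1) (\<lambda>(s, t). K G' (s, q) t)"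
        using continuous_on_compose2[OF contK[OF G'(3)], of "{s. c - 1 < Re s} \<times> {0..1}" "\<lambda>y. ((fst y, q), snd y)"] \<open>q > 0\<close>
        by (force simp: case_prod_unfold D_def intro!: continuous_intros)
    qed (use that in \<open>auto simp: convex_halfspace_Re_gt\<close>)
    then show ?thesis
      using that by (simp add: at_within_open[of _ "{s. c - 1 < Re s}"] open_halfspace_Re_gt)
  qed
  then have "((\<lambda>s. left_shift G s q) has_field_derivative
      integral {0..1} (K G (s, q)) + (s - 1) * integral {0..1} (K G' (s, q))) (at s)"
    if "c - 1 < Re s" "q > 0" for s q
    using that unfolding left_shift_def K_def by (auto intro!: derivative_eq_intros)
  moreover have "continuous_on D (\<lambda>(s, q). left_shift G s q)"
    using contI[OF G'(2)] unfolding left_shift_def K_def case_prod_unfold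
    by (auto intro!: continuous_intros)
  moreover have "continuous_on D (\<lambda>(s, q). integral {0..1} (K G (s, q)) + (s - 1) * integral {0..1} (K G' (s, q)))"
    using contI[OF G'(2)] contI[OF G'(3)] unfolding case_prod_unfold
    by (auto intro!: continuous_intros)
  ultimately show ?thesis
    unfolding smooth_family_def D_def
    by (intro exI[of _ "\<lambda>s q. integral {0..1} (K G (s, q)) + (s - 1) * integral {0..1} (K G' (s, q))"]) auto
qed

section \<open>The derivative of the shifted family in \<open>q\<close>\<close>

lemma has_vector_derivative_along_segment:
  fixes P :: "real \<Rightarrow> complex"
  assumes "(P has_vector_derivative P') (at (1 + t * (q - 1)))"
  shows "((\<lambda>t. P (1 + t * (q - 1))) has_vector_derivative of_real (q - 1) * P') (at t within A)"
proof -
  have "((\<lambda>t. 1 + t * (q - 1)) has_vector_derivative (q - 1)) (at t within A)"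
    by (auto intro!: derivative_eq_intros simp flip: has_real_derivative_iff_has_vector_derivative)
  from vector_diff_chain_within[OF this has_vector_derivative_at_within[OF assms]]
  show ?thesis by (simp add: o_def scaleR_conv_of_real)
qed

text \<open>After the substitution u = 1 + t (q - 1) this is the integral of \<open>g\<close> from 1
  to \<open>q\<close>.\<close>

lemma segment_integral_has_vector_derivative:
  fixes g :: "real \<Rightarrow> complex"
  assumes "continuous_on {0<..} g" "q > 0"
  shows "((\<lambda>q. integral {0..1} (\<lambda>t. of_real (q - 1) * g (1 + t * (q - 1)))) has_vector_derivative g q) (at q)"
proof -
  \<comment> \<open>A compact interval of positive reals with both 1 and \<open>q\<close> in its
    interior, on which \<open>g\<close> has an antiderivative.\<close>
  define a b where "a = min q 1 / 2" and "b = max q 1 + 1"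
  have ab: "0 < a" "a < q" "q < b" "a < 1" "1 < b" using assms(2) by (auto simp: a_def b_def)
  have "continuous_on {a..b} g"
    by (rule continuous_on_subset[OF assms(1)]) (use ab in auto)
  then obtain P where P: "\<And>x. x \<in> {a..b} \<Longrightarrow> (P has_vector_derivative g x) (at x within {a..b})"
    using antiderivative_continuous by metis
  have P': "(P has_vector_derivative g x) (at x)" if "a < x" "x < b" for x
    using P[of x] that by (simp add: at_within_Icc_at)
  have eq: "integral {0..1} (\<lambda>t. of_real (r - 1) * g (1 + t * (r - 1))) = P r - P 1" if r: "r \<in> {a<..<b}" for r
  proof -
    have "((\<lambda>t. of_real (r - 1) * g (1 + t * (r - 1))) has_integral P (1 + 1 * (r - 1)) - P (1 + 0 * (r - 1))) {0..1}"
    proof (rule fundamental_theorem_of_calculus)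
      fix t :: real assume t: "t \<in> {0..1}"
      have "1 + t * (r - 1) \<in> {a<..<b}"
      proof -
        have "convex {a<..<b}" by simp
        from convexD_alt[OF this, of 1 r t] show ?thesis
          using ab r t by (simp add: algebra_simps)
      qed
      then have "(P has_vector_derivative g (1 + t * (r - 1))) (at (1 + t * (r - 1)))"
        by (simp add: P')
      then show "((\<lambda>t. P (1 + t * (r - 1))) has_vector_derivative of_real (r - 1) * g (1 + t * (r - 1))) (at t within {0..1})"
        by (rule has_vector_derivative_along_segment)
    qed simp
    from integral_unique[OF this] show ?thesis by simp
  qed
  have "(P has_vector_derivative g q) (at q)"
    using ab by (intro P')
  then have "((\<lambda>r. P r - P 1) has_vector_derivative g q - 0) (at q)"
    by (rule has_vector_derivative_diff[OF _ has_vector_derivative_const])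
  then have "((\<lambda>r. P r - P 1) has_vector_derivative g q) (at q)" by simp
  then show ?thesis
  proof (rule has_vector_derivative_transform_within_open)
    show "open {a<..<b}" "q \<in> {a<..<b}" using ab by auto
  qed (simp only: eq)
qed

lemma left_shift_has_vector_derivative:
  assumes "smooth_family c G" "c - 1 < Re s" "q > 0"
  shows "(left_shift G s has_vector_derivative - (s - 1) * G (s + 1) q) (at q)"
proof -
  have cont: "continuous_on {0<..} (G (s + 1))"
    by (rule smooth_family_continuous[OF assms(1)]) (use assms(2) in simp)
  define I where "I = integral {0..1} (\<lambda>t. of_real (1 - t) * G (s + 1) (1 + t))"
  define J where "J = (\<lambda>q. integral {0..1} (\<lambda>t. of_real (q - 1) * G (s + 1) (1 + t * (q - 1))))"
  \<comment> \<open>Only \<open>J\<close> depends on the parameter; \<open>I\<close> fixes the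
    constant of integration.\<close>
  have eq: "left_shift G s r = 1 + (s - 1) * (I - J r)" if "r > 0" for r
    unfolding left_shift_def I_def J_def
    using that
    by (subst integral_diff)
       (auto intro!: integrable_continuous_interval continuous_intros continuous_on_compose2[OF cont] segment_pos)
  have J: "(J has_vector_derivative G (s + 1) q) (at q)"
    unfolding J_def by (rule segment_integral_has_vector_derivative[OF cont assms(3)])
  have "((\<lambda>r. 1 + (s - 1) * (I - J r)) has_vector_derivative 0 + (s - 1) * (0 - G (s + 1) q)) (at q)"
    by (rule has_vector_derivative_add[OF has_vector_derivative_const
          has_vector_derivative_mult_right[OF has_vector_derivative_diff[OF has_vector_derivative_const J]]])
  then have "((\<lambda>r. 1 + (s - 1) * (I - J r)) has_vector_derivative - (s - 1) * G (s + 1) q) (at q)"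
    by (rule has_vector_derivative_eq_rhs) (simp add: algebra_simps)
  then show ?thesis
  proof (rule has_vector_derivative_transform_within_open)
    show "open {0::real<..}" "q \<in> {0<..}" using assms(3) by auto
  qed (simp add: eq)
qed

text \<open>For Re s > 2 the series at s - 1 converges too, so both integrals can be evaluated. By
  parts the first is zeta(s,1) - 1/(s - 1); subtracting the second adds zeta(s,q) -
  zeta(s,1).\<close>

lemma left_shift_hurwitz_series_right:
  assumes "Re s > 2" "q > 0"
  shows "left_shift (\<lambda>s q. (s - 1) * hurwitz_series s q) s q = (s - 1) * hurwitz_series s q"
proof -
  let ?L = hurwitz_series
  have s: "Re s > 1" "Re (s - 1) > 1" "s \<noteq> 1" using assms by auto
  have d0: "((\<lambda>t. ?L s (1 + t)) has_vector_derivative - s * ?L (s + 1) (1 + t)) (at t within A)"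
       "((\<lambda>t. ?L (s - 1) (1 + t)) has_vector_derivative - (s - 1) * ?L s (1 + t)) (at t within A)" if "t \<ge> 0" for t A
  proof -
    have pos: "1 + t * (2 - 1) > 0" using that by simp
    show "((\<lambda>t. ?L s (1 + t)) has_vector_derivative - s * ?L (s + 1) (1 + t)) (at t within A)"
      using has_vector_derivative_along_segment[OF hurwitz_series_has_vector_derivative[OF s(1) pos]] by simp
    show "((\<lambda>t. ?L (s - 1) (1 + t)) has_vector_derivative - (s - 1) * ?L s (1 + t)) (at t within A)"
      using has_vector_derivative_along_segment[OF hurwitz_series_has_vector_derivative[OF s(2) pos]] by simp
  qed
  \<comment> \<open>The antiderivative comes from integrating by parts; zeta(s,1+t) itself is
    integrated through zeta(s-1,1+t).\<close>
  have "((\<lambda>t. - (of_real (1 - t) * ?L s (1 + t)) - ?L (s - 1) (1 + t) / (1 - s)) has_vector_derivative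
           of_real (1 - t) * (s * ?L (s + 1) (1 + t))) (at t within A)" if "t \<ge> 0" for t A
  proof -
    have "((\<lambda>t. of_real (1 - t) :: complex) has_vector_derivative of_real (- 1)) (at t within A)"
      by (intro has_vector_derivative_of_real)
         (auto intro!: derivative_eq_intros)
    note * = has_vector_derivative_diff[OF has_vector_derivative_minus[OF has_vector_derivative_mult[OF this d0(1)[OF that]]]
           has_vector_derivative_divide[OF d0(2)[OF that], where a = "1 - s"]]
    show ?thesis
      by (rule has_vector_derivative_eq_rhs[OF *]) (use s in \<open>simp add: divide_simps; simp add: algebra_simps\<close>)
  qed
  then have "((\<lambda>t. of_real (1 - t) * (s * ?L (s + 1) (1 + t))) has_integral
       (- (of_real (1 - 1) * ?L s (1 + 1)) - ?L (s - 1) (1 + 1) / (1 - s)) -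
       (- (of_real (1 - 0) * ?L s (1 + 0)) - ?L (s - 1) (1 + 0) / (1 - s))) {0..1}"
    by (intro fundamental_theorem_of_calculus) auto
  moreover have "((\<lambda>t. of_real (q - 1) * (- s * ?L (s + 1) (1 + t * (q - 1)))) has_integral
       ?L s (1 + 1 * (q - 1)) - ?L s (1 + 0 * (q - 1))) {0..1}"
    using assms by (intro fundamental_theorem_of_calculus has_vector_derivative_along_segment
         hurwitz_series_has_vector_derivative segment_pos) auto
  ultimately have "((\<lambda>t. of_real (1 - t) * (s * ?L (s + 1) (1 + t)) + of_real (q - 1) * (- s * ?L (s + 1) (1 + t * (q - 1)))) has_integral
      (?L (s - 1) 1 - ?L (s - 1) 2) / (1 - s) + ?L s q) {0..1}"
    by (rule has_integral_eq_rhs[OF has_integral_add]) (simp add: diff_divide_distrib)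
  \<comment> \<open>The two series differ only in the first term, which is 1; this accounts for the
    constant 1 in \<open>left_shift\<close>.\<close>
  moreover have "?L (s - 1) 1 - ?L (s - 1) 2 = 1"
  proof -
    have "(\<Sum>n. hurwitz_term (Suc n) (s - 1) 1) = ?L (s - 1) 1 - hurwitz_term 0 (s - 1) 1"
      unfolding hurwitz_series_def using s by (intro suminf_split_head summable_hurwitz_term) auto
    moreover have "hurwitz_term 0 (s - 1) 1 = 1" "\<And>n. hurwitz_term (Suc n) (s - 1) 1 = hurwitz_term n (s - 1) 2"
      by (auto simp: hurwitz_term_def add.commute add.left_commute)
    ultimately show ?thesis by (simp add: hurwitz_series_def)
  qed
  ultimately have "integral {0..1} (\<lambda>t. of_real (1 - t) * (s * ?L (s + 1) (1 + t)) - of_real (q - 1) * (s * ?L (s + 1) (1 + t * (q - 1))))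
     = 1 / (1 - s) + ?L s q"
    by (intro integral_unique) simp
  moreover have "(s - 1) * (1 / (1 - s)) = -1" using s by (simp add: divide_simps)
  ultimately show ?thesis
    by (simp add: left_shift_def ring_distribs)
qed

lemma analytic_continuation_halfplane:
  assumes "f holomorphic_on {s. c < Re s}" "g holomorphic_on {s. c < Re s}"
    and "\<And>s. Re s > d \<Longrightarrow> f s = g s" "Re s > c" "c \<le> d"
  shows "f s = g s"
proof (rule analytic_continuation_open[of "{s. d < Re s}" "{s. c < Re s}" f g])
  have "complex_of_real (d + 1) \<in> {s. d < Re s}" by simp
  then show "{s. d < Re s} \<noteq> {}" by blast
qed (use assms in \<open>auto simp: open_halfspace_Re_gt convex_halfspace_Re_gt intro: convex_connected\<close>)

section \<open>Analytic continuation\<close>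

text \<open>The continuation of (s - 1) zeta(s,q) to Re s > 1 - k. The factor s - 1 removes the pole
  that later shifts would otherwise meet.\<close>

definition hurwitz_extension :: "nat \<Rightarrow> complex \<Rightarrow> real \<Rightarrow> complex" where
  "hurwitz_extension k = (left_shift ^^ k) (\<lambda>s q. (s - 1) * hurwitz_series s q)"

lemma smooth_family_hurwitz_extension: "smooth_family (1 - real k) (hurwitz_extension k)"
proof (induction k)
  case 0
  obtain L' where L':
    "\<And>s q. 1 < Re s \<Longrightarrow> 0 < q \<Longrightarrow> ((\<lambda>s. hurwitz_series s q) has_field_derivative L' s q) (at s)"
    "continuous_on ({s. 1 < Re s} \<times> {0<..}) (\<lambda>(s, q). hurwitz_series s q)"
    "continuous_on ({s. 1 < Re s} \<times> {0<..}) (\<lambda>(s, q). L' s q)"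
    using smooth_family_hurwitz_series unfolding smooth_family_def by blast
  show ?case
    unfolding smooth_family_def hurwitz_extension_def
    by (rule exI[of _ "\<lambda>s q. hurwitz_series s q + (s - 1) * L' s q"])
       (use L' in \<open>auto intro!: derivative_eq_intros continuous_intros simp: case_prod_unfold\<close>)
next
  case (Suc k)
  from smooth_family_left_shift[OF Suc] show ?case
    by (simp add: hurwitz_extension_def)
qed

lemma left_shift_cong:
  assumes "\<And>r. r > 0 \<Longrightarrow> G (s + 1) r = H (s + 1) r" "q > 0"
  shows "left_shift G s q = left_shift H s q"
proof -
  have "integral {0..1} (\<lambda>t. of_real (1 - t) * G (s + 1) (1 + t) - of_real (q - 1) * G (s + 1) (1 + t * (q - 1)))
    = integral {0..1} (\<lambda>t. of_real (1 - t) * H (s + 1) (1 + t) - of_real (q - 1) * H (s + 1) (1 + t * (q - 1)))"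
    using assms by (intro integral_cong) (auto simp: segment_pos)
  then show ?thesis by (simp only: left_shift_def)
qed

text \<open>For k = 0 the identity theorem extends the agreement from Re s > 2. The induction step
  uses that \<open>left_shift\<close> at \<open>s\<close> sees its argument only at s + 1 and at
  positive parameters.\<close>

lemma hurwitz_extension_Suc:
  assumes "1 - real k < Re s" "q > 0"
  shows "hurwitz_extension (Suc k) s q = hurwitz_extension k s q"
  using assms
proof (induction k arbitrary: s q)
  case 0
  show ?case
  proof (rule analytic_continuation_halfplane[where c = 1 and d = 2 and s = s
        and f = "\<lambda>s. hurwitz_extension (Suc 0) s q" and g = "\<lambda>s. hurwitz_extension 0 s q"])
    show "(\<lambda>s. hurwitz_extension (Suc 0) s q) holomorphic_on {s. 1 < Re s}"
      using smooth_family_holomorphic[OF smooth_family_hurwitz_extension[of "Suc 0"] 0(2)]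
      by (rule holomorphic_on_subset) auto
    show "(\<lambda>s. hurwitz_extension 0 s q) holomorphic_on {s. 1 < Re s}"
      using smooth_family_holomorphic[OF smooth_family_hurwitz_extension[of 0] 0(2)] by simp
    show "hurwitz_extension (Suc 0) s q = hurwitz_extension 0 s q" if "2 < Re s" for s
      using left_shift_hurwitz_series_right[OF that 0(2)] by (simp add: hurwitz_extension_def)
  qed (use 0 in auto)
next
  case (Suc k)
  have "left_shift (hurwitz_extension (Suc k)) s q = left_shift (hurwitz_extension k) s q"
    using Suc.prems by (intro left_shift_cong Suc.IH) auto
  then show ?case by (simp add: hurwitz_extension_def)
qed

lemma hurwitz_extension_eq:
  assumes "j \<le> k" "1 - real j < Re s" "q > 0"
  shows "hurwitz_extension k s q = hurwitz_extension j s q"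
  using assms by (induction k rule: dec_induct) (auto simp: hurwitz_extension_Suc)

text \<open>This glues the levels into (s - 1) zeta(s,q) on the whole plane. The 2 in the index
  makes 1 - k < Re s strict.\<close>

definition hurwitz_entire :: "complex \<Rightarrow> real \<Rightarrow> complex" where
  "hurwitz_entire s = hurwitz_extension (nat \<lceil>2 - Re s\<rceil>) s"

lemma hurwitz_entire_eq:
  assumes "1 - real k < Re s" "q > 0"
  shows "hurwitz_entire s q = hurwitz_extension k s q"
proof -
  have "1 - real (nat \<lceil>2 - Re s\<rceil>) < Re s" by linarith
  then show ?thesis
    unfolding hurwitz_entire_def using assms by (metis hurwitz_extension_eq linear)
qed

lemma hurwitz_continuation_hurwitz_entire:
  assumes "q > 0"
  shows "hurwitz_continuation q (\<lambda>s. hurwitz_entire s q / (s - 1))"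
proof -
  have "(\<lambda>s. hurwitz_entire s q) field_differentiable at s" for s
  proof -
    define k where "k = nat \<lceil>2 - Re s\<rceil>"
    have k: "1 - real k < Re s" unfolding k_def by linarith
    \<comment> \<open>The index in \<open>hurwitz_entire\<close> jumps with Re s, but on this
      half-plane the fixed level \<open>k\<close> gives the same values.\<close>
    have "(\<lambda>s. hurwitz_entire s q) holomorphic_on {s. 1 - real k < Re s}"
      by (rule holomorphic_transform[OF smooth_family_holomorphic[OF smooth_family_hurwitz_extension assms]])
         (use assms in \<open>auto simp: hurwitz_entire_eq\<close>)
    then show ?thesis
      using k by (auto simp: open_halfspace_Re_gt holomorphic_on_imp_differentiable_at)
  qed
  then have "(\<lambda>s. hurwitz_entire s q) holomorphic_on (- {1})"
    by (simp add: holomorphic_on_def field_differentiable_at_within)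
  moreover have "(\<lambda>n. (of_nat n + of_real q) powr - s) sums (hurwitz_entire s q / (s - 1))" if "Re s > 1" for s
  proof -
    have "s \<noteq> 1" using that by auto
    then have "hurwitz_entire s q / (s - 1) = hurwitz_series s q"
      using hurwitz_entire_eq[of 0 s q] that assms by (simp add: hurwitz_extension_def)
    then show ?thesis
      using summable_sums[OF summable_hurwitz_term[OF that assms]] assms
      by (simp add: powr_eq_hurwitz_term hurwitz_series_def)
  qed
  ultimately show ?thesis
    by (auto simp: hurwitz_continuation_def intro!: holomorphic_intros)
qed

section \<open>Differential and difference equations in \<open>q\<close>\<close>

lemma hurwitz_zeta_eq_hurwitz_entire:
  assumes "q > 0" "s \<noteq> 1"
  shows "hurwitz_zeta s q = hurwitz_entire s q / (s - 1)"
  using hurwitz_zeta_eq[OF hurwitz_continuation_hurwitz_entire] assms by simp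

lemma hurwitz_zeta_has_vector_derivative:
  assumes "s \<noteq> 0" "s \<noteq> 1" "q > 0"
  shows "(hurwitz_zeta s has_vector_derivative - s * hurwitz_zeta (s + 1) q) (at q)"
proof -
  define k where "k = nat \<lceil>2 - Re s\<rceil>"
  have k: "1 - real k - 1 < Re s" unfolding k_def by linarith
  have "(left_shift (hurwitz_extension k) s has_vector_derivative
           - (s - 1) * hurwitz_extension k (s + 1) q) (at q)"
    by (rule left_shift_has_vector_derivative[OF smooth_family_hurwitz_extension k assms(3)])
  from has_vector_derivative_divide[OF this, where a = "s - 1"]
  have "((\<lambda>r. hurwitz_extension (Suc k) s r / (s - 1)) has_vector_derivative
           - (s - 1) * hurwitz_extension k (s + 1) q / (s - 1)) (at q)"
    unfolding hurwitz_extension_def funpow.simps o_apply .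
  \<comment> \<open>Level \<open>k\<close> at s + 1 carries the factor (s + 1) - 1 = s, the source
    of the coefficient -s.\<close>
  moreover have "- (s - 1) * hurwitz_extension k (s + 1) q / (s - 1) = - s * hurwitz_zeta (s + 1) q"
    using assms k hurwitz_entire_eq[of k "s + 1" q] by (simp add: hurwitz_zeta_eq_hurwitz_entire field_simps)
  ultimately have "((\<lambda>r. hurwitz_extension (Suc k) s r / (s - 1)) has_vector_derivative
           - s * hurwitz_zeta (s + 1) q) (at q)"
    by simp
  then show ?thesis
  proof (rule has_vector_derivative_transform_within_open)
    show "open {0::real<..}" "q \<in> {0<..}" using assms(3) by auto
    show "hurwitz_extension (Suc k) s r / (s - 1) = hurwitz_zeta s r" if "r \<in> {0<..}" for r
      using assms k that hurwitz_entire_eq[of "Suc k" s r] by (simp add: hurwitz_zeta_eq_hurwitz_entire)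
  qed
qed

text \<open>Splitting off the first term shows that the right side continues the series with
  parameter \<open>q\<close>; uniqueness of the continuation does the rest.\<close>

lemma hurwitz_zeta_add_one:
  assumes "s \<noteq> 1" "q > 0"
  shows "hurwitz_zeta s q = of_real q powr (- s) + hurwitz_zeta s (q + 1)"
proof -
  define f where "f = (\<lambda>s. hurwitz_entire s (q + 1) / (s - 1))"
  have f: "hurwitz_continuation (q + 1) f"
    unfolding f_def using assms by (intro hurwitz_continuation_hurwitz_entire) auto
  have "hurwitz_continuation q (\<lambda>s. of_real q powr (- s) + f s)"
    unfolding hurwitz_continuation_def
  proof (intro conjI allI impI)
    show "(\<lambda>s. of_real q powr (- s) + f s) holomorphic_on - {1}"
      using f unfolding hurwitz_continuation_def by (auto intro!: holomorphic_intros)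
    fix s :: complex assume "1 < Re s"
    with f have "(\<lambda>n. (of_nat n + of_real (q + 1)) powr (- s)) sums f s"
      by (simp add: hurwitz_continuation_def)
    then have "(\<lambda>n. (of_nat (Suc n) + of_real q) powr (- s)) sums f s"
      by (simp add: algebra_simps)
    from sums_Suc[OF this] show "(\<lambda>n. (of_nat n + of_real q) powr (- s)) sums (of_real q powr (- s) + f s)"
      by (simp add: add.commute)
  qed
  from hurwitz_zeta_eq[OF this assms(1)] hurwitz_zeta_eq[OF f assms(1)] show ?thesis by simp
qed

section \<open>Moments on the unit interval\<close>

text \<open>The integrand is the derivative of q^n zeta(z-1,q). The factor \<open>1 - 0 ^ n\<close>
  covers n = 0, where the two boundary values cancel; the truncated \<open>n - 1\<close> then meets
  the factor 0.\<close>

lemma integral_by_parts_hurwitz_zeta: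
  fixes z :: real
  assumes "z \<le> 0"
  shows "((\<lambda>q. of_nat n * of_real q ^ (n - 1) * hurwitz_zeta (of_real z - 1) q +
            (1 - of_real z) * (of_real q ^ n * hurwitz_zeta (of_real z) q))
          has_integral (1 - 0 ^ n) * riemann_zeta (of_real z - 1)) {0..1}"
proof -
  define s where "s = complex_of_real z - 1"
  have Re_s: "Re s = z - 1" by (simp add: s_def)
  with assms have s: "s \<noteq> 0" "s \<noteq> 1" by auto
  \<comment> \<open>The continuous extension of zeta(z-1,q) to q = 0: the exponent 1 - z is positive
    and \<open>0 powr (1 - z)\<close> is 0, so only the value at q + 1 = 1 remains.\<close>
  define Z where "Z = (\<lambda>q. of_real (q powr (1 - z)) + hurwitz_zeta s (q + 1))"
  have Z: "Z q = hurwitz_zeta s q" if "q > 0" for q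
    using hurwitz_zeta_add_one[OF s(2) that] powr_of_real[of q "1 - z"] that by (simp add: Z_def s_def)
  have Z0: "Z 0 = riemann_zeta s"
    by (simp add: Z_def riemann_zeta_def)
  have der: "(hurwitz_zeta s has_vector_derivative (1 - of_real z) * hurwitz_zeta (of_real z) q) (at q)" if "q > 0" for q
    using hurwitz_zeta_has_vector_derivative[OF s that] by (simp add: s_def)
  have "continuous_on {0<..} (hurwitz_zeta s)"
    by (intro continuous_at_imp_continuous_on ballI has_vector_derivative_continuous[OF der]) simp
  then have "continuous_on {0..1} (\<lambda>q. hurwitz_zeta s (q + 1))"
    by (rule continuous_on_compose2) (auto intro!: continuous_intros)
  moreover have "continuous_on {0..1} (\<lambda>q. q powr (1 - z))"
    using assms by (intro continuous_on_powr') auto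
  ultimately have contZ: "continuous_on {0..1} Z"
    unfolding Z_def by (intro continuous_on_add continuous_on_of_real)
  have "((\<lambda>q. of_nat n * of_real q ^ (n - 1) * hurwitz_zeta s q +
            (1 - of_real z) * (of_real q ^ n * hurwitz_zeta (of_real z) q))
          has_integral of_real 1 ^ n * Z 1 - of_real 0 ^ n * Z 0) {0..1}"
  \<comment> \<open>This version asks for the derivative only on 0 < q < 1, where \<open>Z\<close>
    agrees with \<open>hurwitz_zeta s\<close>; at 0 continuity is enough.\<close>
  proof (rule fundamental_theorem_of_calculus_interior)
    show "continuous_on {0..1} (\<lambda>q. of_real q ^ n * Z q)"
      by (intro continuous_intros contZ)
    fix q :: real assume q: "q \<in> {0<..<1}"
    have dZ: "(Z has_vector_derivative (1 - of_real z) * hurwitz_zeta (of_real z) q) (at q)"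
    proof (rule has_vector_derivative_transform_within_open[OF der])
      show "0 < q" "open {0::real<..}" "q \<in> {0<..}" using q by auto
    qed (simp add: Z)
    have "((\<lambda>q. of_real (q ^ n) :: complex) has_vector_derivative of_real (real n * q ^ (n - 1))) (at q)"
      by (intro has_vector_derivative_of_real) (auto intro!: derivative_eq_intros)
    note * = has_vector_derivative_mult[OF this dZ]
    have "((\<lambda>q. of_real (q ^ n) * Z q) has_vector_derivative
            of_nat n * of_real q ^ (n - 1) * hurwitz_zeta s q +
            (1 - of_real z) * (of_real q ^ n * hurwitz_zeta (of_real z) q)) (at q)"
      by (rule has_vector_derivative_eq_rhs[OF *]) (use q in \<open>simp add: Z mult_ac\<close>)
    then show "((\<lambda>q. of_real q ^ n * Z q) has_vector_derivative
            of_nat n * of_real q ^ (n - 1) * hurwitz_zeta s q +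
            (1 - of_real z) * (of_real q ^ n * hurwitz_zeta (of_real z) q)) (at q)"
      by (simp only: of_real_power)
  qed simp
  moreover have "of_real 1 ^ n * Z 1 - of_real 0 ^ n * Z 0 = (1 - 0 ^ n) * riemann_zeta s"
    using Z[of 1] Z0 by (simp add: riemann_zeta_def algebra_simps)
  ultimately show ?thesis by (simp add: s_def)
qed

definition moment_value :: "nat \<Rightarrow> real \<Rightarrow> complex" where
  "moment_value n z = fact n * (\<Sum>j=1..n. (- 1) ^ (j + 1) * (riemann_zeta (of_real z - of_nat j) /
                   (pochhammer (1 - of_real z) j * fact (n - j + 1))))"

lemma one_minus_of_real_neq_0: "z \<le> 0 \<Longrightarrow> 1 - complex_of_real z \<noteq> 0"
  by (auto simp: complex_eq_iff)

text \<open>The term j = 1 gives zeta(z-1). The others, reindexed by (1-z)_(j+1) = (1-z) (2-z)_j,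
  form the sum for z - 1 with opposite sign. This is the recurrence that integration by parts gives
  for the moments.\<close>

lemma moment_value_Suc:
  assumes "z \<le> 0"
  shows "(1 - of_real z) * moment_value (Suc n) z =
           riemann_zeta (of_real z - 1) - of_nat (Suc n) * moment_value n (z - 1)"
proof -
  define w where "w = 1 - complex_of_real z"
  have w: "w \<noteq> 0"
    unfolding w_def using assms by (rule one_minus_of_real_neq_0)
  define a where "a = (\<lambda>n j z. (- 1) ^ (j + 1) * (riemann_zeta (of_real z - of_nat j) /
                   (pochhammer (1 - of_real z) j * fact (n - j + 1))))"
  have a: "w * a (Suc n) (Suc j) z = - a n j (z - 1)" for j
  proof -
    have "pochhammer w (Suc j) = w * pochhammer (1 - of_real (z - 1)) j"
      by (simp add: pochhammer_rec w_def algebra_simps)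
    moreover have "complex_of_real z - of_nat (Suc j) = of_real (z - 1) - of_nat j" by simp
    moreover have "Suc n - Suc j + 1 = n - j + 1" by simp
    ultimately show ?thesis
      using w by (simp only: a_def w_def[symmetric]) simp
  qed
  have mv: "moment_value m y = fact m * (\<Sum>j=1..m. a m j y)" for m y
    by (simp only: moment_value_def a_def)
  have shift: "(\<Sum>j=1..Suc n. f j) = f 1 + (\<Sum>j=1..n. f (Suc j))" for f :: "nat \<Rightarrow> complex"
    using sum.atLeast_Suc_atMost[of 1 "Suc n" f] sum.shift_bounds_cl_Suc_ivl[of f 1 n] by simp
  have "moment_value (Suc n) z = fact (Suc n) * (a (Suc n) 1 z + (\<Sum>j=1..n. a (Suc n) (Suc j) z))"
    by (simp only: mv shift)
  then have "w * moment_value (Suc n) z = fact (Suc n) * (w * a (Suc n) 1 z) + fact (Suc n) * (\<Sum>j=1..n. w * a (Suc n) (Suc j) z)"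
    by (simp only: ring_distribs sum_distrib_left mult.left_commute)
  also have "fact (Suc n) * (w * a (Suc n) 1 z) = riemann_zeta (of_real z - 1)"
    using w by (simp add: a_def w_def del: fact_Suc)
  also have "fact (Suc n) * (\<Sum>j=1..n. w * a (Suc n) (Suc j) z) = - (of_nat (Suc n) * moment_value n (z - 1))"
    by (simp add: a sum_negf mv)
  finally show ?thesis by (simp add: w_def)
qed

lemma has_integral_hurwitz_zeta_moment:
  fixes z :: real
  assumes "z \<le> 0"
  shows "((\<lambda>q. of_real q ^ n * hurwitz_zeta (of_real z) q) has_integral moment_value n z) {0..1}"
  using assms
\<comment> \<open>\<open>z\<close> must vary because the step passes to z - 1, which is again
  nonpositive. Integrability comes along, since the new integral is a difference of existing ones
  divided by 1 - z.\<close>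
proof (induction n arbitrary: z)
  case 0
  have "((\<lambda>q. (1 - of_real z) * (of_real q ^ 0 * hurwitz_zeta (of_real z) q)) has_integral 0) {0..1}"
    using integral_by_parts_hurwitz_zeta[OF 0, of 0] by simp
  from has_integral_mult_right[OF this, of "inverse (1 - of_real z)"] one_minus_of_real_neq_0[OF 0] show ?case
    by (simp add: moment_value_def mult.assoc[symmetric])
next
  case (Suc n)
  have "((\<lambda>q. of_nat (Suc n) * (of_real q ^ n * hurwitz_zeta (of_real z - 1) q)) has_integral
          of_nat (Suc n) * moment_value n (z - 1)) {0..1}"
    using Suc.IH[of "z - 1"] Suc.prems by (intro has_integral_mult_right) simp
  from has_integral_diff[OF integral_by_parts_hurwitz_zeta[OF Suc.prems, of "Suc n"] this]
  have "((\<lambda>q. (1 - of_real z) * (of_real q ^ Suc n * hurwitz_zeta (of_real z) q)) has_integral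
          (1 - of_real z) * moment_value (Suc n) z) {0..1}"
    unfolding moment_value_Suc[OF Suc.prems] by (simp add: mult.assoc del: of_nat_Suc power_Suc)
  from has_integral_mult_right[OF this, of "inverse (1 - of_real z)"] one_minus_of_real_neq_0[OF Suc.prems] show ?case
    by (simp add: mult.assoc[symmetric] del: power_Suc)
qed

text \<open>Negating the factors z - j, ..., z - 1 gives 1 - z, ..., j - z in reverse order.\<close>

lemma pochhammer_reflect:
  "pochhammer (z - of_nat j) j = (- 1) ^ j * pochhammer (1 - z :: complex) j"
  using pochhammer_minus[of "of_nat j - z" j] by (simp add: algebra_simps)

theorem theorem3p7:
  fixes n :: nat and z :: real
  assumes "n \<ge> 1" and "z \<le> 0"
  shows "(\<lambda>q::real. of_real q ^ n * hurwitz_zeta (of_real z) q) integrable_on {0..1} \<and>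
    integral {0..1} (\<lambda>q::real. of_real q ^ n * hurwitz_zeta (of_real z) q) =
      - fact n * (\<Sum>j=1..n. riemann_zeta (of_real z - of_nat j) /
                   (pochhammer (of_real z - of_nat j) j * fact (n - j + 1))) \<and>
    - fact n * (\<Sum>j=1..n. riemann_zeta (of_real z - of_nat j) /
                   (pochhammer (of_real z - of_nat j) j * fact (n - j + 1))) =
      fact n * (\<Sum>j=1..n. (- 1) ^ (j + 1) * (riemann_zeta (of_real z - of_nat j) /
                   (pochhammer (1 - of_real z) j * fact (n - j + 1))))"
proof -
  \<comment> \<open>The two closed forms agree term by term: the leading minus and the reflection
    sign combine to (-1)^(j+1).\<close>
  have "- (riemann_zeta (of_real z - of_nat j) / (pochhammer (of_real z - of_nat j) j * fact (n - j + 1))) =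
          (- 1) ^ (j + 1) * (riemann_zeta (of_real z - of_nat j) / (pochhammer (1 - of_real z) j * fact (n - j + 1)))" for j
    unfolding pochhammer_reflect by (cases "even j") simp_all
  then have "- fact n * (\<Sum>j=1..n. riemann_zeta (of_real z - of_nat j) /
                   (pochhammer (of_real z - of_nat j) j * fact (n - j + 1))) = moment_value n z"
    unfolding moment_value_def by (simp only: mult_minus_left mult_minus_right[symmetric] sum_negf[symmetric])
  with has_integral_hurwitz_zeta_moment[OF assms(2), of n] show ?thesis
    by (simp only: integral_unique has_integral_integrable moment_value_def[symmetric] simp_thms)
qed

end
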